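(* For any compositions $\beta,\alpha_1,\dots,\alpha_r$, the limit $$\lim_{n_1,\dots,n_r\to\infty}\mathcal{K}_{\beta*0^{n_1}*\alpha_1*\cdots*0^{n_r}*\alpha_r}(y_1,\dots,y_{\ell(\beta)},x_{1,1},\dots,x_{1,n_1},z_{1,1},\dots,z_{1,\ell(\alpha_1)},\dots,x_{r,1},\dots,x_{r,n_r},z_{r,1},\dots,z_{r,\ell(\alpha_r)})$$ exists as a formal power series (i.e. the coefficient of each monomial is eventually constant as all $n_i\to\infty$).
   Context: Compositions are finite sequences of nonnegative integers, $\ell$ denotes length, $*$ concatenation, $0^m$ a string of $m$ zeros. Isobaric divided difference: $\xi_i f=\frac{x_if-x_{i+1}s_if}{x_i-x_{i+1}}$ where $s_i$ swaps $x_i,x_{i+1}$. Key polynomials $\mathcal{K}_\alpha(x_1,\dots,x_n)$ for $\alpha\in\mathbb{Z}_{\ge0}^n$ are the unique polynomials with $\mathcal{K}_\alpha=x^\alpha$ if $\alpha_1\ge\cdots\ge\alpha_n$ and $\mathcal{K}_{s_i\alpha}=\xi_i\mathcal{K}_\alpha$ whenever $\alpha_i>\alpha_{i+1}$ ($s_i\alpha$ swaps entries $i,i+1$); the variables are substituted in the listed order. *)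

theory Defs
  imports "HOL-Library.Poly_Mapping" "HOL-Combinatorics.Transposition"
begin

(* Polynomials over the integers with variables indexed by 'v: an exponent vector
   'v \<Rightarrow>\<^sub>0 nat is a monomial, and a polynomial maps finitely many monomials to
   nonzero coefficients.  Multiplication is the convolution of HOL-Library.Poly_Mapping. *)
type_synonym 'v monom = "'v \<Rightarrow>\<^sub>0 nat"
type_synonym 'v mpoly = "'v monom \<Rightarrow>\<^sub>0 int"

(* Formal power series, possibly in infinitely many variables. *)
type_synonym 'v mfps = "'v monom \<Rightarrow> int"

definition mcoeff :: "'v mpoly \<Rightarrow> 'v monom \<Rightarrow> int" where
  "mcoeff p m = Poly_Mapping.lookup p m"

definition mconst :: "int \<Rightarrow> 'v mpoly" where
  "mconst c = Poly_Mapping.single 0 c"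

definition mvar :: "'v \<Rightarrow> 'v mpoly" where
  "mvar v = Poly_Mapping.single (Poly_Mapping.single v 1) 1"

definition msubst :: "('v \<Rightarrow> 'w mpoly) \<Rightarrow> 'v mpoly \<Rightarrow> 'w mpoly" where
  "msubst \<sigma> p =
     (\<Sum>m\<in>Poly_Mapping.keys p. mconst (mcoeff p m) *
        (\<Prod>v\<in>Poly_Mapping.keys m. \<sigma> v ^ Poly_Mapping.lookup m v))"

(* The variables x_1, x_2, ... are numbered from 0 here, like list positions. *)
definition swap_vars :: "nat \<Rightarrow> nat mpoly \<Rightarrow> nat mpoly" where
  "swap_vars i f = msubst (\<lambda>j. mvar (transpose i (Suc i) j)) f"

(* The quotient (x_i f - x_{i+1} s_i f) / (x_i - x_{i+1}); the polynomial ring is an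
   integral domain and the numerator is a multiple of the denominator, so exactly one
   polynomial g satisfies the description. *)
definition isobaric :: "nat \<Rightarrow> nat mpoly \<Rightarrow> nat mpoly" where
  "isobaric i f =
     (THE g. (mvar i - mvar (Suc i)) * g = mvar i * f - mvar (Suc i) * swap_vars i f)"

definition swap_entries :: "nat \<Rightarrow> nat list \<Rightarrow> nat list" where
  "swap_entries i \<alpha> = \<alpha>[i := \<alpha> ! Suc i, Suc i := \<alpha> ! i]"

(* A composition of length n is a list of length n, and its key polynomial is a
   polynomial in the variables 0, ..., n - 1. *)
definition is_key_family :: "(nat list \<Rightarrow> nat mpoly) \<Rightarrow> bool" where
  "is_key_family K \<longleftrightarrow>
     (\<forall>\<alpha>. sorted_wrt (\<ge>) \<alpha> \<longrightarrow> K \<alpha> = (\<Prod>i<length \<alpha>. mvar i ^ (\<alpha> ! i))) \<and>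
     (\<forall>\<alpha> i. Suc i < length \<alpha> \<and> \<alpha> ! i > \<alpha> ! Suc i \<longrightarrow>
        K (swap_entries i \<alpha>) = isobaric i (K \<alpha>))"

definition key_poly :: "nat list \<Rightarrow> nat mpoly" where
  "key_poly = (THE K. is_key_family K)"

(* Substitution of the variables listed in vs, in this order.  Only the first
   length \<alpha> variables occur in key_poly \<alpha>, so the values of vs ! i beyond the end of vs
   do not matter when length vs = length \<alpha>. *)
definition key_poly_at :: "nat list \<Rightarrow> 'v list \<Rightarrow> 'v mpoly" where
  "key_poly_at \<alpha> vs = msubst (\<lambda>i. mvar (vs ! i)) (key_poly \<alpha>)"

datatype yxz = Y nat | X nat nat | Z nat nat

(* The composition \<beta> * 0^{n_1} * \<alpha>_1 * ... * 0^{n_r} * \<alpha>_r, where as = [\<alpha>_1, ..., \<alpha>_r]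
   and ns = [n_1, ..., n_r]. *)
definition padded_comp :: "nat list \<Rightarrow> nat list list \<Rightarrow> nat list \<Rightarrow> nat list" where
  "padded_comp \<beta> as ns =
     \<beta> @ concat (map (\<lambda>i. replicate (ns ! i) 0 @ as ! i) [0..<length as])"

definition padded_vars :: "nat list \<Rightarrow> nat list list \<Rightarrow> nat list \<Rightarrow> yxz list" where
  "padded_vars \<beta> as ns =
     map Y [0..<length \<beta>] @
     concat (map (\<lambda>i. map (X i) [0..<ns ! i] @ map (Z i) [0..<length (as ! i)]) [0..<length as])"

(* Coefficientwise limit of a family of polynomials indexed by (n_1, ..., n_r), as all
   n_i tend to infinity independently of each other. *)
definition has_mfps_limit :: "nat \<Rightarrow> (nat list \<Rightarrow> 'v mpoly) \<Rightarrow> 'v mfps \<Rightarrow> bool" where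
  "has_mfps_limit r P F \<longleftrightarrow>
     (\<forall>m. \<exists>N. \<forall>ns. length ns = r \<and> (\<forall>n\<in>set ns. n \<ge> N) \<longrightarrow> mcoeff (P ns) m = F m)"

end

(* The key fact is that a zero entry can be deleted: if \<alpha>_i = 0, then setting x_i = 0 in
   K_\<alpha> gives the key polynomial of \<alpha> without its i-th entry, in the remaining variables.
   Indeed, let E_i denote setting x_i = 0.  Up to renumbering the variables, E_i commutes
   with \<xi>_j for j different from i - 1 and i, and E_i \<xi>_i = E_{i+1}; and when \<alpha> is sorted by
   swapping ascents \<alpha>_j < \<alpha>_{j+1}, the remaining case j = i - 1 cannot occur because
   \<alpha>_i = 0.
   Hence setting all x_{i,k} with k > N to zero turns the polynomial for (n_1, ..., n_r) into
   the one for (N, ..., N) as soon as all n_i are at least N, and it does not change the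
   coefficient of a monomial that involves none of these variables.
   That key polynomials exist at all rests on the braid and commutation relations of the
   \<xi>_i. *)

theory Submission
  imports Defs
begin

section \<open>Substitution\<close>

definition monom_subst :: "('v \<Rightarrow> 'w mpoly) \<Rightarrow> 'v monom \<Rightarrow> 'w mpoly" where
  "monom_subst \<sigma> m = (\<Prod>v\<in>Poly_Mapping.keys m. \<sigma> v ^ Poly_Mapping.lookup m v)"

lemma monom_subst_superset:
  assumes "finite A" "Poly_Mapping.keys m \<subseteq> A"
  shows "monom_subst \<sigma> m = (\<Prod>v\<in>A. \<sigma> v ^ Poly_Mapping.lookup m v)"
  unfolding monom_subst_def
  by (rule prod.mono_neutral_left) (use assms in \<open>auto simp: in_keys_iff\<close>)

lemma monom_subst_zero [simp]: "monom_subst \<sigma> 0 = 1"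
  by (simp add: monom_subst_def)

lemma monom_subst_add: "monom_subst \<sigma> (m + n) = monom_subst \<sigma> m * monom_subst \<sigma> n"
proof -
  let ?A = "Poly_Mapping.keys m \<union> Poly_Mapping.keys n"
  have "monom_subst \<sigma> (m + n) = (\<Prod>v\<in>?A. \<sigma> v ^ Poly_Mapping.lookup (m + n) v)"
    using Poly_Mapping.keys_add[of m n] by (intro monom_subst_superset) auto
  also have "\<dots> = (\<Prod>v\<in>?A. \<sigma> v ^ Poly_Mapping.lookup m v) * (\<Prod>v\<in>?A. \<sigma> v ^ Poly_Mapping.lookup n v)"
    by (simp add: lookup_add power_add prod.distrib)
  also have "\<dots> = monom_subst \<sigma> m * monom_subst \<sigma> n"
    by (simp add: monom_subst_superset[of ?A])
  finally show ?thesis .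
qed

lemma msubst_alt:
  "msubst \<sigma> p = (\<Sum>m\<in>Poly_Mapping.keys p. mconst (Poly_Mapping.lookup p m) * monom_subst \<sigma> m)"
  by (simp add: msubst_def mcoeff_def monom_subst_def)

lemma msubst_0 [simp]: "msubst \<sigma> 0 = 0"
  by (simp add: msubst_alt)

lemma msubst_monom: "msubst \<sigma> (Poly_Mapping.single m 1) = monom_subst \<sigma> m"
  by (simp add: msubst_alt mconst_def)

lemma msubst_1 [simp]: "msubst \<sigma> 1 = 1"
  using msubst_monom[of \<sigma> 0] by simp

lemma msubst_mvar [simp]: "msubst \<sigma> (mvar v) = \<sigma> v"
  unfolding mvar_def msubst_monom by (simp add: monom_subst_def)

lemma msubst_add [simp]: "msubst \<sigma> (p + q) = msubst \<sigma> p + msubst \<sigma> q"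
  unfolding msubst_alt
  by (rule setsum_keys_plus_distrib) (simp_all add: mconst_def single_add distrib_right)

lemma msubst_diff [simp]: "msubst \<sigma> (p - q) = msubst \<sigma> p - msubst \<sigma> q"
  by (metis add_diff_cancel_right' diff_add_cancel msubst_add)

lemma msubst_mult [simp]: "msubst \<sigma> (p * q) = msubst \<sigma> p * msubst \<sigma> q"
\<comment> \<open>A polynomial is an element of the free abelian group on monomials, so 0, single
  monomials with coefficient 1 and differences are the only cases.\<close>
proof (induction p rule: frag_induction[OF subset_UNIV])
  case (2 m)
  show ?case
  proof (induction q rule: frag_induction[OF subset_UNIV])
    case (2 n)
    show ?case
      by (simp add: mult_single msubst_monom monom_subst_add)
  qed (auto simp: algebra_simps)
qed (auto simp: algebra_simps)

lemma msubst_power [simp]: "msubst \<sigma> (p ^ k) = msubst \<sigma> p ^ k"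
  by (induction k) auto

lemma msubst_prod [simp]: "msubst \<sigma> (prod f A) = (\<Prod>x\<in>A. msubst \<sigma> (f x))"
  by (induction A rule: infinite_finite_induct) auto

text \<open>The variables generate the polynomial ring over the integers; constants come from 1 by
  differences. Identities between ring homomorphisms thus need checking on variables only.\<close>

lemma mpoly_induct [case_names zero one var diff mult]:
  fixes p :: "'v mpoly"
  assumes "P 0" and "P 1" and var: "\<And>v. P (mvar v)"
    and diff: "\<And>p q. P p \<Longrightarrow> P q \<Longrightarrow> P (p - q)"
    and mult: "\<And>p q. P p \<Longrightarrow> P q \<Longrightarrow> P (p * q)"
  shows "P p"
proof -
  have power: "P (p ^ k)" if "P p" for p k
    using that by (induction k) (auto intro: assms)
  have monom: "P (Poly_Mapping.single m 1)" for m :: "'v monom"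
  proof (induction m rule: update_induct)
    case const
    show ?case using assms by simp
  next
    case (update m a b)
    \<comment> \<open>Here \<open>a\<close> is not yet a key of \<open>m\<close>, so the update
      overwrites nothing and becomes a product of monomials.\<close>
    have upd: "Poly_Mapping.update a b m = Poly_Mapping.single a b + m"
      using update by (intro poly_mapping_eqI)
        (auto simp: lookup_update lookup_add lookup_single in_keys_iff when_def)
    have single_Suc: "Poly_Mapping.single a (Suc k) = Poly_Mapping.single a 1 + Poly_Mapping.single a k" for k
      using single_add[of a 1 k] by simp
    have pow: "Poly_Mapping.single (Poly_Mapping.single a k) 1 = (mvar a ^ k :: 'v mpoly)" for k
    proof (induction k)
      case (Suc k)
      have "Poly_Mapping.single (Poly_Mapping.single a (Suc k)) 1 =
          (mvar a * Poly_Mapping.single (Poly_Mapping.single a k) 1 :: 'v mpoly)"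
        unfolding single_Suc mvar_def by (simp add: mult_single)
      with Suc show ?case by simp
    qed simp
    have "P (mvar a ^ b * Poly_Mapping.single m 1)"
      by (intro mult power var update)
    then show ?case
      by (simp add: upd mult_single flip: pow)
  qed
  show ?thesis
    by (rule frag_induction[OF subset_UNIV]) (use assms monom in auto)
qed

lemma msubst_msubst: "msubst \<sigma> (msubst \<tau> p) = msubst (\<lambda>v. msubst \<sigma> (\<tau> v)) p"
  by (induction p rule: mpoly_induct) auto

lemma msubst_id [simp]: "msubst mvar p = p"
  by (induction p rule: mpoly_induct) auto

lemma msubst_cong: "(\<And>v. \<sigma> v = \<tau> v) \<Longrightarrow> msubst \<sigma> p = msubst \<tau> p"
  by presburger

lemma mvar_eq_iff [simp]: "(mvar v :: 'v mpoly) = mvar w \<longleftrightarrow> v = w"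
proof
  assume eq: "(mvar v :: 'v mpoly) = mvar w"
  show "v = w"
  proof (rule ccontr)
    assume "v \<noteq> w"
    \<comment> \<open>This substitution sends \<open>mvar v\<close> to 0 and \<open>mvar w\<close>
      to 1, which separates the two.\<close>
    let ?\<sigma> = "\<lambda>u. if u = v then 0 else 1 :: 'v mpoly"
    have "msubst ?\<sigma> (mvar v) = msubst ?\<sigma> (mvar w)"
      by (simp only: eq)
    then show False
      using \<open>v \<noteq> w\<close> by simp
  qed
qed auto


lemma mvar_nonzero [simp]: "mvar v \<noteq> 0"
  by (simp add: mvar_def)


section \<open>Isobaric divided differences\<close>

lemma swap_vars_simps [simp]:
  "swap_vars i 0 = 0" "swap_vars i 1 = 1"
  "swap_vars i (p + q) = swap_vars i p + swap_vars i q"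
  "swap_vars i (p - q) = swap_vars i p - swap_vars i q"
  "swap_vars i (p * q) = swap_vars i p * swap_vars i q"
  "swap_vars i (mvar j) = mvar (transpose i (Suc i) j)"
  by (simp_all add: swap_vars_def)

lemma swap_vars_involutory [simp]: "swap_vars i (swap_vars i p) = p"
  by (simp add: swap_vars_def msubst_msubst)

lemma swap_vars_commute:
  assumes "Suc i < j"
  shows "swap_vars i (swap_vars j p) = swap_vars j (swap_vars i p)"
  by (induction p rule: mpoly_induct) (use assms in \<open>auto simp: transpose_def\<close>)

lemma swap_vars_braid:
  "swap_vars i (swap_vars (Suc i) (swap_vars i p)) =
   swap_vars (Suc i) (swap_vars i (swap_vars (Suc i) p))"
  by (induction p rule: mpoly_induct) (auto simp: transpose_def)

text \<open>The map taking p to p - s_i p is a twisted derivation, so divisibility passes to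
  products. On a variable its value is 0 or plus or minus the divisor.\<close>

lemma dvd_diff_swap_vars: "mvar i - mvar (Suc i) dvd p - swap_vars i p"
proof (induction p rule: mpoly_induct)
  case (var v)
  have "mvar i - mvar (Suc i) dvd mvar (Suc i) - (mvar i :: nat mpoly)"
    by (metis dvd_minus_iff dvd_refl minus_diff_eq)
  then show ?case by (auto simp: transpose_def)
next
  case (diff p q)
  have "p - q - swap_vars i (p - q) = (p - swap_vars i p) - (q - swap_vars i q)"
    by simp
  with diff show ?case by (metis dvd_diff)
next
  case (mult p q)
  have "p * q - swap_vars i (p * q) =
      (p - swap_vars i p) * q + swap_vars i p * (q - swap_vars i q)"
    by (simp add: algebra_simps)
  with mult show ?case by (metis dvd_add dvd_mult dvd_mult2)
qed auto

lemma mvar_diff_nonzero [simp]: "v \<noteq> w \<Longrightarrow> (mvar v :: nat mpoly) - mvar w \<noteq> 0"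
  by simp

lemma isobaric_ex1:
  "\<exists>!g. (mvar i - mvar (Suc i)) * g = mvar i * f - mvar (Suc i) * swap_vars i f"
proof -
  \<comment> \<open>The numerator equals (x_i - x_{i+1}) f + x_{i+1} (f - s_i f), so the quotient is
    f + x_{i+1} g. Uniqueness is cancellation in an integral domain.\<close>
  obtain g where g: "f - swap_vars i f = (mvar i - mvar (Suc i)) * g"
    using dvd_diff_swap_vars by (meson dvdE)
  have "(mvar i - mvar (Suc i)) * (f + mvar (Suc i) * g) =
      (mvar i - mvar (Suc i)) * f + mvar (Suc i) * ((mvar i - mvar (Suc i)) * g)"
    by (simp only: algebra_simps)
  also have "\<dots> = mvar i * f - mvar (Suc i) * swap_vars i f"
    unfolding g[symmetric] by (simp add: algebra_simps)
  finally have eq: "(mvar i - mvar (Suc i)) * (f + mvar (Suc i) * g) =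
      mvar i * f - mvar (Suc i) * swap_vars i f" .
  show ?thesis
    by (rule ex1I, rule eq) (metis eq mult_left_cancel mvar_diff_nonzero n_not_Suc_n)
qed

lemma isobaric:
  "(mvar i - mvar (Suc i)) * isobaric i f = mvar i * f - mvar (Suc i) * swap_vars i f"
  unfolding isobaric_def by (rule theI'[OF isobaric_ex1])

lemma isobaric_eqI:
  "(mvar i - mvar (Suc i)) * g = mvar i * f - mvar (Suc i) * swap_vars i f \<Longrightarrow> isobaric i f = g"
  using isobaric_ex1 isobaric by blast

text \<open>The hypotheses make \<sigma> intertwine s_i with s_j, so \<sigma> carries the defining
  equation of one operator to that of the other. The remaining variables may go to 0 or be
  renumbered, as the deletion argument requires.\<close>

lemma msubst_isobaric:
  assumes "\<sigma> i = mvar j" "\<sigma> (Suc i) = mvar (Suc j)"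
    and "\<And>k. k \<noteq> i \<Longrightarrow> k \<noteq> Suc i \<Longrightarrow> swap_vars j (\<sigma> k) = \<sigma> k"
  shows "msubst \<sigma> (isobaric i f) = isobaric j (msubst \<sigma> f)"
proof (rule isobaric_eqI[symmetric])
  have swap: "msubst \<sigma> (swap_vars i f) = swap_vars j (msubst \<sigma> f)"
    by (induction f rule: mpoly_induct) (use assms in \<open>auto simp: transpose_def\<close>)
  show "(mvar j - mvar (Suc j)) * msubst \<sigma> (isobaric i f) =
      mvar j * msubst \<sigma> f - mvar (Suc j) * swap_vars j (msubst \<sigma> f)"
    using arg_cong[OF isobaric[of i f], of "msubst \<sigma>"] by (simp add: assms swap)
qed

section \<open>Commutation and braid relations of the operators\<close>

lemma swap_vars_isobaric:
  assumes "Suc i < j"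
  shows "swap_vars j (isobaric i f) = isobaric i (swap_vars j f)"
    and "swap_vars i (isobaric j f) = isobaric j (swap_vars i f)"
  unfolding swap_vars_def[of j] swap_vars_def[of i]
  by (rule msubst_isobaric; use assms in \<open>auto simp: transpose_def\<close>)+

text \<open>After multiplication by both denominators, each side becomes the same signed sum
  \<open>?R\<close> over the four products of s_i and s_j.\<close>

lemma isobaric_commute:
  assumes "Suc i < j"
  shows "isobaric i (isobaric j f) = isobaric j (isobaric i f)"
proof -
  define x x' y y' :: "nat mpoly"
    where xy: "x = mvar i" "x' = mvar (Suc i)" "y = mvar j" "y' = mvar (Suc j)"
  let ?D = "(x - x') * (y - y')"
  let ?si = "swap_vars i" and ?sj = "swap_vars j"
  let ?R = "x * y * f - x * y' * ?sj f - x' * y * ?si f + x' * y' * ?si (?sj f)"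
  have i: "(x - x') * isobaric i p = x * p - x' * ?si p" for p
    unfolding xy by (rule isobaric)
  have j: "(y - y') * isobaric j p = y * p - y' * ?sj p" for p
    unfolding xy by (rule isobaric)
  have "?D * isobaric i (isobaric j f) =
      (y - y') * ((x - x') * isobaric i (isobaric j f))"
    by (simp only: ac_simps)
  also have "\<dots> = x * ((y - y') * isobaric j f) - x' * ((y - y') * isobaric j (?si f))"
    unfolding i swap_vars_isobaric(2)[OF assms] by (simp add: algebra_simps)
  also have "\<dots> = ?R"
    unfolding j swap_vars_commute[OF assms] by (simp add: algebra_simps)
  finally have 1: "?D * isobaric i (isobaric j f) = ?R" .
  have "?D * isobaric j (isobaric i f) =
      (x - x') * ((y - y') * isobaric j (isobaric i f))"
    by (simp only: ac_simps)
  also have "\<dots> = y * ((x - x') * isobaric i f) - y' * ((x - x') * isobaric i (?sj f))"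
    unfolding j swap_vars_isobaric(1)[OF assms] by (simp add: algebra_simps)
  also have "\<dots> = ?R"
    unfolding i by (simp add: algebra_simps)
  finally have "?D * isobaric i (isobaric j f) = ?D * isobaric j (isobaric i f)"
    using 1 by simp
  moreover have "?D \<noteq> 0"
    using assms by (simp add: xy)
  ultimately show ?thesis
    by (meson mult_left_cancel)
qed

text \<open>Multiplied by the Vandermonde product \<open>T\<close>, both sides become
  \<open>?W\<close>, the alternating sum of w(x^2 y f) over the six permutations w of x, y, z.
  Cancelling \<open>T\<close> gives the relation.\<close>

lemma isobaric_braid:
  "isobaric i (isobaric (Suc i) (isobaric i f)) = isobaric (Suc i) (isobaric i (isobaric (Suc i) f))"
proof -
  define x y z :: "nat mpoly" where xyz: "x = mvar i" "y = mvar (Suc i)" "z = mvar (Suc (Suc i))"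
  define s t where st: "s = swap_vars i" "t = swap_vars (Suc i)"
  define T where "T = (x - y) * (x - z) * (y - z)"
  have nz: "x - y \<noteq> 0" "y - z \<noteq> 0" "T \<noteq> 0"
    by (simp_all add: xyz T_def)
  have sxyz: "s x = y" "s y = x" "s z = z" "t x = x" "t y = z" "t z = y"
    by (auto simp: st xyz transpose_def)
  have hom: "s (p - q) = s p - s q" "s (p * q) = s p * s q"
    "t (p - q) = t p - t q" "t (p * q) = t p * t q" for p q
    by (simp_all add: st)
  have inv: "s (s p) = p" "t (t p) = p" for p
    by (simp_all add: st)
  have braid: "t (s (t f)) = s (t (s f))"
    by (simp add: st swap_vars_braid)
  have i: "(x - y) * isobaric i p = x * p - y * s p" for p
    unfolding xyz st by (rule isobaric)
  have j: "(y - z) * isobaric (Suc i) p = y * p - z * t p" for p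
    unfolding xyz st by (rule isobaric)
  let ?W = "x\<^sup>2 * y * f - x * y\<^sup>2 * s f - x\<^sup>2 * z * t f + x * z\<^sup>2 * t (s f) + y\<^sup>2 * z * s (t f)
      - y * z\<^sup>2 * s (t (s f))"

  \<comment> \<open>Applying \<open>t\<close> to the defining equation turns the denominator x - y
    into x - z, which is also a factor of \<open>T\<close>.\<close>
  have ti: "(x - z) * t (isobaric i f) = x * t f - z * t (s f)"
    using arg_cong[OF i[of f], of t] by (simp add: hom sxyz)
  define h where "h = isobaric (Suc i) (isobaric i f)"
  have "T * h = y * (x - z) * ((x - y) * isobaric i f) - z * (x - y) * ((x - z) * t (isobaric i f))"
    using arg_cong[OF j[of "isobaric i f"], of "\<lambda>p. (x - y) * (x - z) * p"]
    by (simp add: T_def h_def algebra_simps)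
  then have h: "T * h = y * (x - z) * (x * f - y * s f) - z * (x - y) * (x * t f - z * t (s f))"
    by (simp only: i ti)
  \<comment> \<open>\<open>T\<close> is antisymmetric, so \<open>s\<close> negates it and s(T h) = -
    T s(h).\<close>
  have sh: "- T * s h = x * (y - z) * (y * s f - x * f) - z * (y - x) * (y * s (t f) - z * s (t (s f)))"
  proof -
    have "- T * s h = s (T * h)"
      unfolding T_def by (simp only: hom sxyz) (simp add: algebra_simps)
    then show ?thesis
      unfolding h by (simp add: hom sxyz inv)
  qed
  have "(x - y) * (T * isobaric i h) = T * ((x - y) * isobaric i h)"
    by (simp only: ac_simps)
  also have "\<dots> = x * (T * h) + y * (- T * s h)"
    unfolding i by (simp add: algebra_simps)
  also have "\<dots> = (x - y) * ?W"
    unfolding h sh by (simp add: algebra_simps power2_eq_square)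
  finally have 1: "T * isobaric i h = ?W"
    using nz by (metis mult_left_cancel)

  \<comment> \<open>The mirror computation for the other word; \<open>braid\<close> then identifies
    the two expressions for the longest permutation.\<close>
  have sj: "(x - z) * s (isobaric (Suc i) f) = x * s f - z * s (t f)"
    using arg_cong[OF j[of f], of s] by (simp add: hom sxyz)
  define k where "k = isobaric i (isobaric (Suc i) f)"
  have "T * k = x * (x - z) * ((y - z) * isobaric (Suc i) f) - y * (y - z) * ((x - z) * s (isobaric (Suc i) f))"
    using arg_cong[OF i[of "isobaric (Suc i) f"], of "\<lambda>p. (y - z) * (x - z) * p"]
    by (simp add: T_def k_def algebra_simps)
  then have k: "T * k = x * (x - z) * (y * f - z * t f) - y * (y - z) * (x * s f - z * s (t f))"
    by (simp only: j sj)
  have tk: "- T * t k = x * (x - y) * (z * t f - y * f) - z * (z - y) * (x * t (s f) - y * s (t (s f)))"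
  proof -
    have "- T * t k = t (T * k)"
      unfolding T_def by (simp only: hom sxyz) (simp add: algebra_simps)
    then show ?thesis
      unfolding k by (simp add: hom sxyz inv braid)
  qed
  have "(y - z) * (T * isobaric (Suc i) k) = T * ((y - z) * isobaric (Suc i) k)"
    by (simp only: ac_simps)
  also have "\<dots> = y * (T * k) + z * (- T * t k)"
    unfolding j by (simp add: algebra_simps)
  also have "\<dots> = (y - z) * ?W"
    unfolding k tk by (simp add: algebra_simps power2_eq_square)
  finally have 2: "T * isobaric (Suc i) k = ?W"
    using nz by (metis mult_left_cancel)
  from 1 2 show ?thesis
    unfolding h_def k_def using nz(3) by (metis mult_left_cancel)
qed


section \<open>Existence and uniqueness of key polynomials\<close>

definition ascent :: "nat \<Rightarrow> nat list \<Rightarrow> bool" where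
  "ascent i \<alpha> \<longleftrightarrow> Suc i < length \<alpha> \<and> \<alpha> ! i < \<alpha> ! Suc i"

lemma length_swap_entries [simp]: "length (swap_entries i \<alpha>) = length \<alpha>"
  by (simp add: swap_entries_def)

lemma nth_swap_entries:
  "Suc i < length \<alpha> \<Longrightarrow> swap_entries i \<alpha> ! j = \<alpha> ! transpose i (Suc i) j"
  by (auto simp: swap_entries_def nth_list_update transpose_def)

lemma swap_entries_involutory [simp]:
  "Suc i < length \<alpha> \<Longrightarrow> swap_entries i (swap_entries i \<alpha>) = \<alpha>"
  by (rule nth_equalityI) (auto simp: nth_swap_entries)

lemma swap_entries_commute:
  assumes "Suc i < j" "Suc j < length \<alpha>"
  shows "swap_entries i (swap_entries j \<alpha>) = swap_entries j (swap_entries i \<alpha>)"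
  using assms by (intro nth_equalityI) (auto simp: nth_swap_entries transpose_def)

lemma swap_entries_braid:
  assumes "Suc (Suc i) < length \<alpha>"
  shows "swap_entries i (swap_entries (Suc i) (swap_entries i \<alpha>)) =
    swap_entries (Suc i) (swap_entries i (swap_entries (Suc i) \<alpha>))"
  using assms by (intro nth_equalityI) (auto simp: nth_swap_entries transpose_def)

lemma sorted_wrt_ge_iff_no_ascent: "sorted_wrt (\<ge>) \<alpha> \<longleftrightarrow> (\<nexists>i. ascent i \<alpha>)"
  for \<alpha> :: "nat list"
  by (subst sorted_wrt_iff_nth_Suc_transp) (auto simp: ascent_def transp_def linorder_not_less, metis not_le)

text \<open>This is the sum of \<open>j * \<alpha> ! j\<close> over all positions \<open>j\<close>.\<close>

fun position_sum :: "nat list \<Rightarrow> nat" where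
  "position_sum [] = 0"
| "position_sum (a # \<alpha>) = sum_list \<alpha> + position_sum \<alpha>"

lemma position_sum_swap_entries:
  assumes "ascent i \<alpha>"
  shows "position_sum (swap_entries i \<alpha>) < position_sum \<alpha>"
proof -
  \<comment> \<open>The sum is carried along because the recursion of \<open>position_sum\<close>
    adds the sum of the tail. At the swap itself the measure drops by the difference of the two
    entries.\<close>
  have "sum_list (swap_entries i \<alpha>) = sum_list \<alpha> \<and>
      position_sum (swap_entries i \<alpha>) < position_sum \<alpha>"
    using assms
  proof (induction i arbitrary: \<alpha>)
    case 0
    then obtain a b \<gamma> where "\<alpha> = a # b # \<gamma>"
      by (cases \<alpha>; cases "tl \<alpha>") (auto simp: ascent_def)
    with 0 show ?case by (simp add: ascent_def swap_entries_def)
  next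
    case (Suc i)
    then obtain a \<gamma> where \<alpha>: "\<alpha> = a # \<gamma>" "ascent i \<gamma>"
      by (cases \<alpha>) (auto simp: ascent_def)
    moreover have "swap_entries (Suc i) (a # \<gamma>) = a # swap_entries i \<gamma>"
      by (simp add: swap_entries_def)
    ultimately show ?case
      using Suc.IH[of \<gamma>] by simp
  qed
  then show ?thesis ..
qed

text \<open>Always sorting at the leftmost ascent fixes one definite candidate for the key
  polynomials; \<open>key_ascent\<close> shows that any other ascent gives the same result.\<close>

function key :: "nat list \<Rightarrow> nat mpoly" where
  "key \<alpha> =
     (if \<exists>i. ascent i \<alpha>
      then isobaric (LEAST i. ascent i \<alpha>) (key (swap_entries (LEAST i. ascent i \<alpha>) \<alpha>))
      else (\<Prod>i<length \<alpha>. mvar i ^ (\<alpha> ! i)))"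
  by auto
termination
proof (relation "measure position_sum")
  fix \<alpha> :: "nat list"
  assume "\<exists>i. ascent i \<alpha>"
  then have "ascent (LEAST i. ascent i \<alpha>) \<alpha>" by (rule LeastI_ex)
  then show "(swap_entries (LEAST i. ascent i \<alpha>) \<alpha>, \<alpha>) \<in> measure position_sum"
    by (simp add: position_sum_swap_entries)
qed simp

declare key.simps [simp del]

lemma key_dominant:
  "(\<nexists>i. ascent i \<alpha>) \<Longrightarrow> key \<alpha> = (\<Prod>i<length \<alpha>. mvar i ^ (\<alpha> ! i))"
  by (subst key.simps) simp

text \<open>A diamond argument by induction on \<open>position_sum\<close>: the leftmost ascent and
  \<open>i\<close> are joined by the braid relation if adjacent and by commutation if further
  apart.\<close>

lemma key_ascent: "ascent i \<alpha> \<Longrightarrow> key \<alpha> = isobaric i (key (swap_entries i \<alpha>))"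
proof (induction \<alpha> arbitrary: i rule: measure_induct_rule[of position_sum])
  case (less \<alpha>)
  define l where "l = (LEAST i. ascent i \<alpha>)"
  have l: "ascent l \<alpha>"
    unfolding l_def using less.prems by (rule LeastI)
  have key: "key \<alpha> = isobaric l (key (swap_entries l \<alpha>))"
    using less.prems by (subst key.simps) (auto simp: l_def)
  have IH: "key (swap_entries j \<alpha>) = isobaric k (key (swap_entries k (swap_entries j \<alpha>)))"
    if "ascent j \<alpha>" "ascent k (swap_entries j \<alpha>)" for j k
    using less.IH[OF position_sum_swap_entries] that by blast
  have IH2: "key (swap_entries k (swap_entries j \<alpha>)) =
      isobaric h (key (swap_entries h (swap_entries k (swap_entries j \<alpha>))))"
    if "ascent j \<alpha>" "ascent k (swap_entries j \<alpha>)" "ascent h (swap_entries k (swap_entries j \<alpha>))"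
    for h j k
    using that less.IH position_sum_swap_entries order.strict_trans by meson
  have "l \<le> i"
    unfolding l_def using less.prems by (rule Least_le)
  then consider "i = l" | "i = Suc l" | "Suc l < i" by linarith
  then show ?case
  proof cases
    case 1
    then show ?thesis by (simp add: key)
  next
    case 2
    from less.prems l have len: "Suc (Suc l) < length \<alpha>"
      and lt: "\<alpha> ! l < \<alpha> ! Suc l" "\<alpha> ! Suc l < \<alpha> ! Suc (Suc l)"
      by (auto simp: ascent_def 2)
    \<comment> \<open>The three entries strictly increase, so both words of length three swap at
      ascents only, and both reverse the triple.\<close>
    then have asc: "ascent (Suc l) (swap_entries l \<alpha>)"
      "ascent l (swap_entries (Suc l) (swap_entries l \<alpha>))"
      "ascent l (swap_entries (Suc l) \<alpha>)"
      "ascent (Suc l) (swap_entries l (swap_entries (Suc l) \<alpha>))"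
      by (simp_all add: ascent_def nth_swap_entries transpose_def)
    have "key (swap_entries l \<alpha>) = isobaric (Suc l) (isobaric l
        (key (swap_entries l (swap_entries (Suc l) (swap_entries l \<alpha>)))))"
      unfolding IH[OF l asc(1)] IH2[OF l asc(1,2)] ..
    moreover have "key (swap_entries (Suc l) \<alpha>) = isobaric l (isobaric (Suc l)
        (key (swap_entries (Suc l) (swap_entries l (swap_entries (Suc l) \<alpha>)))))"
      unfolding IH[OF less.prems[unfolded 2] asc(3)] IH2[OF less.prems[unfolded 2] asc(3,4)] ..
    ultimately show ?thesis
      by (simp add: key 2 isobaric_braid swap_entries_braid[OF len])
  next
    case 3
    with less.prems l have "ascent i (swap_entries l \<alpha>)" "ascent l (swap_entries i \<alpha>)"
      by (auto simp: ascent_def nth_swap_entries transpose_def)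
    with less.prems l have "key (swap_entries l \<alpha>) = isobaric i (key (swap_entries i (swap_entries l \<alpha>)))"
      "key (swap_entries i \<alpha>) = isobaric l (key (swap_entries l (swap_entries i \<alpha>)))"
      by (auto intro: IH)
    moreover have "swap_entries l (swap_entries i \<alpha>) = swap_entries i (swap_entries l \<alpha>)"
      using 3 less.prems by (intro swap_entries_commute) (auto simp: ascent_def)
    ultimately show ?thesis
      by (simp add: key isobaric_commute[OF 3])
  qed
qed

text \<open>A descent of \<alpha> at \<open>i\<close> is an ascent of
  \<open>swap_entries i \<alpha>\<close>, so the recursive condition is \<open>key_ascent\<close>
  read backwards.\<close>

lemma is_key_family_key: "is_key_family key"
  unfolding is_key_family_def
proof (intro conjI allI impI)
  fix \<alpha> :: "nat list"
  assume "sorted_wrt (\<ge>) \<alpha>"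
  then show "key \<alpha> = (\<Prod>i<length \<alpha>. mvar i ^ (\<alpha> ! i))"
    by (intro key_dominant) (simp add: sorted_wrt_ge_iff_no_ascent)
next
  fix \<alpha> :: "nat list" and i
  assume "Suc i < length \<alpha> \<and> \<alpha> ! i > \<alpha> ! Suc i"
  then show "key (swap_entries i \<alpha>) = isobaric i (key \<alpha>)"
    by (subst key_ascent[of i]) (auto simp: ascent_def nth_swap_entries)
qed

text \<open>Swapping at an ascent lowers \<open>position_sum\<close>, so the two conditions
  determine every value by induction.\<close>

lemma is_key_family_unique:
  assumes "is_key_family K"
  shows "K = key"
proof
  fix \<alpha>
  show "K \<alpha> = key \<alpha>"
  proof (induction \<alpha> rule: measure_induct_rule[of position_sum])
    case (less \<alpha>)
    show ?case
    proof (cases "\<exists>i. ascent i \<alpha>")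
      case False
      then show ?thesis
        using assms by (simp add: key_dominant is_key_family_def sorted_wrt_ge_iff_no_ascent)
    next
      case True
      then obtain i where i: "ascent i \<alpha>" ..
      then have "K (swap_entries i (swap_entries i \<alpha>)) = isobaric i (K (swap_entries i \<alpha>))"
        using assms unfolding is_key_family_def
        by (auto simp: ascent_def nth_swap_entries simp del: swap_entries_involutory)
      then show ?thesis
        using i less[OF position_sum_swap_entries[OF i]] key_ascent[OF i] by (simp add: ascent_def)
    qed
  qed
qed

lemma key_poly_eq_key: "key_poly = key"
  unfolding key_poly_def using is_key_family_key is_key_family_unique by (rule the_equality)


section \<open>Deleting a zero entry\<close>

text \<open>Being a polynomial in the first variables is expressed as invariance under killing the
  others; the operators that occur act within the range and preserve this.\<close>

lemma key_only_first_vars: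
  "msubst (\<lambda>j. if j < length \<alpha> then mvar j else 0) (key \<alpha>) = key \<alpha>"
proof (induction \<alpha> rule: measure_induct_rule[of position_sum])
  case (less \<alpha>)
  show ?case
  proof (cases "\<exists>i. ascent i \<alpha>")
    case False
    then show ?thesis by (simp add: key_dominant)
  next
    case True
    then obtain i where i: "ascent i \<alpha>" ..
    show ?thesis
      unfolding key_ascent[OF i]
      by (subst msubst_isobaric[where j = i])
        (use i less[OF position_sum_swap_entries[OF i]] in \<open>auto simp: ascent_def\<close>)
  qed
qed

text \<open>The operation E_i of the proof idea, with the renumbering of the later variables built
  in.\<close>

definition delete_var :: "nat \<Rightarrow> nat \<Rightarrow> nat mpoly" where
  "delete_var i j = (if j < i then mvar j else if j = i then 0 else mvar (j - 1))"

lemma msubst_delete_var_isobaric: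
  "msubst (delete_var i) (isobaric i f) = msubst (delete_var (Suc i)) f"
proof -
  have "msubst (delete_var i) (swap_vars i f) = msubst (delete_var (Suc i)) f"
    unfolding swap_vars_def msubst_msubst
    by (rule msubst_cong) (auto simp: delete_var_def transpose_def)
  \<comment> \<open>Under E_i, x_i vanishes and x_{i+1} is renumbered to \<open>mvar i\<close>, so
    only the second term of the numerator survives.\<close>
  then have "- mvar i * msubst (delete_var i) (isobaric i f) = - mvar i * msubst (delete_var (Suc i)) f"
    using arg_cong[OF isobaric[of i f], of "msubst (delete_var i)"]
    by (simp add: delete_var_def)
  then show ?thesis
    by simp
qed

definition delete_entry :: "nat \<Rightarrow> 'a list \<Rightarrow> 'a list" where
  "delete_entry i xs = take i xs @ drop (Suc i) xs"

lemma length_delete_entry [simp]: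
  "i < length xs \<Longrightarrow> length (delete_entry i xs) = length xs - 1"
  by (simp add: delete_entry_def)

lemma nth_delete_entry:
  "i < length xs \<Longrightarrow> delete_entry i xs ! j = xs ! (if j < i then j else Suc j)"
  by (auto simp: delete_entry_def nth_append)

lemma map_delete_entry: "map f (delete_entry i xs) = delete_entry i (map f xs)"
  by (simp add: delete_entry_def take_map drop_map)

lemma key_delete_zero:
  assumes "i < length \<alpha>" "\<alpha> ! i = 0"
  shows "msubst (delete_var i) (key \<alpha>) = key (delete_entry i \<alpha>)"
  using assms
proof (induction \<alpha> arbitrary: i rule: measure_induct_rule[of position_sum])
  case (less \<alpha>)
  show ?case
  proof (cases "\<exists>j. ascent j \<alpha>")
    case False
    then have "sorted_wrt (\<ge>) \<alpha>"
      by (simp add: sorted_wrt_ge_iff_no_ascent)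
    then have sorted: "\<alpha> ! k \<le> \<alpha> ! j" if "j \<le> k" "k < length \<alpha>" for j k
      using that by (cases "j = k") (auto simp: sorted_wrt_iff_nth_less)
    \<comment> \<open>In a weakly decreasing list every entry after a zero is zero, so both
      monomials involve only variables before \<open>i\<close>, which E_i leaves alone.\<close>
    then have zero: "\<alpha> ! j = 0" if "i \<le> j" "j < length \<alpha>" for j
      using that less.prems by (metis le_zero_eq)
    have no_ascent: "\<nexists>j. ascent j (delete_entry i \<alpha>)"
      using less.prems by (auto simp: ascent_def nth_delete_entry not_less intro!: sorted)
    have "(\<Prod>j<length \<alpha>. delete_var i j ^ (\<alpha> ! j)) = (\<Prod>j<i. delete_var i j ^ (\<alpha> ! j))"
      using less.prems zero by (intro prod.mono_neutral_right) auto
    moreover have "(\<Prod>j<length \<alpha> - 1. mvar j ^ (delete_entry i \<alpha> ! j)) =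
        (\<Prod>j<i. mvar j ^ (delete_entry i \<alpha> ! j) :: nat mpoly)"
      using less.prems zero by (intro prod.mono_neutral_right) (auto simp: nth_delete_entry)
    ultimately show ?thesis
      using False no_ascent less.prems by (simp add: key_dominant delete_var_def nth_delete_entry)
  next
    case True
    then obtain j where j: "ascent j \<alpha>" ..
    then have len: "Suc j < length \<alpha>"
      by (simp add: ascent_def)
    let ?\<gamma> = "swap_entries j \<alpha>"
    note IH = less.IH[OF position_sum_swap_entries[OF j]]
    \<comment> \<open>An ascent ending at position \<open>i\<close> would need an entry below
      \<alpha>_i = 0.\<close>
    have "Suc j \<noteq> i"
      using j less.prems by (auto simp: ascent_def)
    then consider "j = i" | "Suc j < i" | "i < j" by linarith
    then show ?thesis
    proof cases
      case 1
      \<comment> \<open>The swap moves the zero to \<open>Suc i\<close>, and deleting it there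
        leaves the same list, so the operator is absorbed entirely.\<close>
      then have "msubst (delete_var i) (key \<alpha>) = msubst (delete_var (Suc i)) (key ?\<gamma>)"
        by (simp add: key_ascent[OF j] msubst_delete_var_isobaric)
      also have "\<dots> = key (delete_entry (Suc i) ?\<gamma>)"
        using 1 len less.prems by (intro IH) (auto simp: nth_swap_entries)
      also have "delete_entry (Suc i) ?\<gamma> = delete_entry i \<alpha>"
        using 1 len by (intro nth_equalityI) (auto simp: nth_delete_entry nth_swap_entries transpose_def)
      finally show ?thesis .
    next
      case 2
      have "msubst (delete_var i) (key \<alpha>) = isobaric j (msubst (delete_var i) (key ?\<gamma>))"
        unfolding key_ascent[OF j] using 2
        by (intro msubst_isobaric) (auto simp: delete_var_def transpose_def)
      also have "msubst (delete_var i) (key ?\<gamma>) = key (delete_entry i ?\<gamma>)"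
        using 2 len less.prems by (intro IH) (auto simp: nth_swap_entries transpose_def)
      also have "delete_entry i ?\<gamma> = swap_entries j (delete_entry i \<alpha>)"
        using 2 less.prems
        by (intro nth_equalityI) (auto simp: nth_delete_entry nth_swap_entries transpose_def)
      also have "isobaric j (key \<dots>) = key (delete_entry i \<alpha>)"
        using 2 j less.prems by (intro key_ascent[symmetric]) (auto simp: ascent_def nth_delete_entry)
      finally show ?thesis .
    next
      case 3
      \<comment> \<open>The zero lies to the left of the ascent, so deletion shifts the ascent and
        its two variables down by one.\<close>
      then obtain k where k: "j = Suc k" "i \<le> k"
        by (cases j) auto
      have "msubst (delete_var i) (key \<alpha>) = isobaric k (msubst (delete_var i) (key ?\<gamma>))"
        unfolding key_ascent[OF j] using k
        by (intro msubst_isobaric) (auto simp: delete_var_def transpose_def)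
      also have "msubst (delete_var i) (key ?\<gamma>) = key (delete_entry i ?\<gamma>)"
        using 3 len less.prems by (intro IH) (auto simp: nth_swap_entries transpose_def)
      also have "delete_entry i ?\<gamma> = swap_entries k (delete_entry i \<alpha>)"
        using k len
        by (intro nth_equalityI) (auto simp: nth_delete_entry nth_swap_entries transpose_def)
      also have "isobaric k (key \<dots>) = key (delete_entry i \<alpha>)"
        using k j by (intro key_ascent[symmetric]) (auto simp: ascent_def nth_delete_entry)
      finally show ?thesis .
    qed
  qed
qed


section \<open>Setting variables to zero\<close>

definition kill_vars :: "'v set \<Rightarrow> 'v mpoly \<Rightarrow> 'v mpoly" where
  "kill_vars S = msubst (\<lambda>v. if v \<in> S then 0 else mvar v)"

text \<open>Monomials avoiding S are fixed and those meeting S are sent to 0, hence a coefficient at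
  a monomial avoiding S is unaffected.\<close>

lemma mcoeff_kill_vars:
  assumes "Poly_Mapping.keys m \<inter> S = {}"
  shows "mcoeff (kill_vars S p) m = mcoeff p m"
proof (induction p rule: frag_induction[OF subset_UNIV])
  case (2 n)
  show ?case
  proof (cases "Poly_Mapping.keys n \<inter> S = {}")
    case True
    have "monom_subst (\<lambda>v. if v \<in> S then 0 else mvar v) n = monom_subst mvar n"
      unfolding monom_subst_def using True by (intro prod.cong) auto
    also have "\<dots> = Poly_Mapping.single n 1"
      by (metis msubst_id msubst_monom)
    finally show ?thesis
      by (simp add: kill_vars_def msubst_monom)
  next
    case False
    then obtain v where "v \<in> Poly_Mapping.keys n" "v \<in> S" by blast
    then have "monom_subst (\<lambda>v. if v \<in> S then 0 else mvar v) n = 0"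
      unfolding monom_subst_def by (intro prod_zero bexI[of _ v]) (auto simp: in_keys_iff zero_power)
    with False assms show ?thesis
      by (auto simp: kill_vars_def msubst_monom mcoeff_def lookup_single)
  qed
qed (simp_all add: kill_vars_def mcoeff_def lookup_minus)

text \<open>Positions beyond the composition get the value 0 in place of an unspecified
  \<open>vs ! j\<close>, so that evaluations of different lengths can be compared variable by
  variable.\<close>

lemma key_poly_at_alt:
  "key_poly_at \<alpha> vs = msubst (\<lambda>j. if j < length \<alpha> then mvar (vs ! j) else 0) (key \<alpha>)"
proof -
  have "key_poly_at \<alpha> vs =
      msubst (\<lambda>i. mvar (vs ! i)) (msubst (\<lambda>j. if j < length \<alpha> then mvar j else 0) (key \<alpha>))"
    unfolding key_poly_at_def key_poly_eq_key key_only_first_vars ..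
  also have "\<dots> = msubst (\<lambda>j. if j < length \<alpha> then mvar (vs ! j) else 0) (key \<alpha>)"
    unfolding msubst_msubst by (rule msubst_cong) simp
  finally show ?thesis .
qed

lemma kill_vars_key_poly_at_delete:
  assumes "i < length \<alpha>" "length vs = length \<alpha>" "\<alpha> ! i = 0" "vs ! i \<in> S"
  shows "kill_vars S (key_poly_at \<alpha> vs) =
    kill_vars S (key_poly_at (delete_entry i \<alpha>) (delete_entry i vs))"
  unfolding key_poly_at_alt key_delete_zero[OF assms(1,3), symmetric] kill_vars_def msubst_msubst
  by (rule msubst_cong) (use assms in \<open>auto simp: delete_var_def nth_delete_entry\<close>)

text \<open>Working with pairs keeps entries and variables aligned. Pairs with variable in S are
  deleted one at a time by \<open>key_delete_zero\<close>; once none is left, killing S changes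
  nothing.\<close>

lemma kill_vars_key_poly_at:
  assumes "\<And>a v. (a, v) \<in> set ps \<Longrightarrow> v \<in> S \<Longrightarrow> a = 0"
  defines "qs \<equiv> filter (\<lambda>p. snd p \<notin> S) ps"
  shows "kill_vars S (key_poly_at (map fst ps) (map snd ps)) = key_poly_at (map fst qs) (map snd qs)"
  using assms(1) unfolding qs_def
proof (induction "length ps" arbitrary: ps rule: less_induct)
  case less
  show ?case
  proof (cases "\<exists>i<length ps. snd (ps ! i) \<in> S")
    case True
    then obtain i where i: "i < length ps" "snd (ps ! i) \<in> S" by blast
    then have "fst (ps ! i) = 0"
      using less.prems[of "fst (ps ! i)" "snd (ps ! i)"] by simp
    then have "kill_vars S (key_poly_at (map fst ps) (map snd ps)) =
        kill_vars S (key_poly_at (map fst (delete_entry i ps)) (map snd (delete_entry i ps)))"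
      using i unfolding map_delete_entry by (intro kill_vars_key_poly_at_delete) auto
    moreover have "a = 0" if "(a, v) \<in> set (delete_entry i ps)" "v \<in> S" for a v
      using that less.prems by (auto simp: delete_entry_def dest: in_set_takeD in_set_dropD)
    moreover have "filter (\<lambda>p. snd p \<notin> S) (delete_entry i ps) = filter (\<lambda>p. snd p \<notin> S) ps"
      using i by (subst (2) id_take_nth_drop[OF i(1)]) (simp add: delete_entry_def)
    ultimately show ?thesis
      using less.hyps[of "delete_entry i ps"] i by simp
  next
    case False
    then have "filter (\<lambda>p. snd p \<notin> S) ps = ps"
      by (intro filter_True) (metis in_set_conv_nth)
    then show ?thesis
      using False unfolding key_poly_at_alt kill_vars_def msubst_msubst
      by (simp, intro msubst_cong) simp
  qed
qed


section \<open>The limit\<close>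

definition padded_pairs :: "nat list \<Rightarrow> nat list list \<Rightarrow> nat list \<Rightarrow> (nat \<times> yxz) list" where
  "padded_pairs \<beta> as ns =
     map (\<lambda>j. (\<beta> ! j, Y j)) [0..<length \<beta>] @
     concat (map (\<lambda>i. map (\<lambda>k. (0, X i k)) [0..<ns ! i] @
       map (\<lambda>k. (as ! i ! k, Z i k)) [0..<length (as ! i)]) [0..<length as])"

lemma map_fst_padded_pairs: "map fst (padded_pairs \<beta> as ns) = padded_comp \<beta> as ns"
  by (simp add: padded_pairs_def padded_comp_def map_concat o_def map_nth map_replicate_const)

lemma map_snd_padded_pairs: "map snd (padded_pairs \<beta> as ns) = padded_vars \<beta> as ns"
  by (simp add: padded_pairs_def padded_vars_def map_concat o_def)

text \<open>The second index counts from 0, so exactly N variables of each sufficiently long block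
  survive.\<close>

definition late_vars :: "nat \<Rightarrow> yxz set" where
  "late_vars N = {X i k |i k. N \<le> k}"

lemma filter_padded_pairs:
  assumes "length ns = length as" "\<forall>n\<in>set ns. N \<le> n"
  shows "filter (\<lambda>p. snd p \<notin> late_vars N) (padded_pairs \<beta> as ns) =
    padded_pairs \<beta> as (replicate (length as) N)"
proof -
  have upt: "filter (\<lambda>k. k < N) [0..<n] = [0..<N]" if "N \<le> n" for n
  proof -
    from that obtain d where "n = N + d" using le_Suc_ex by blast
    then show ?thesis by (simp add: upt_add_eq_append[of 0 N d])
  qed
  show ?thesis
    unfolding padded_pairs_def
    using assms
    by (auto simp: late_vars_def filter_concat filter_map o_def upt not_le
        intro!: arg_cong[where f = concat])
qed

theorem mainTheorem7:
  fixes \<beta> :: "nat list" and as :: "nat list list"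
  shows "\<exists>F :: yxz mfps.
    has_mfps_limit (length as)
      (\<lambda>ns. key_poly_at (padded_comp \<beta> as ns) (padded_vars \<beta> as ns)) F"
proof -
  define P where "P = (\<lambda>ns. key_poly_at (padded_comp \<beta> as ns) (padded_vars \<beta> as ns))"
  \<comment> \<open>The right-hand side depends on \<open>ns\<close> only through its length: this
    is the stability behind the limit.\<close>
  have kill: "kill_vars (late_vars N) (P ns) = P (replicate (length as) N)"
    if "length ns = length as" "\<forall>n\<in>set ns. N \<le> n" for N ns
  proof -
    have "a = 0" if "(a, v) \<in> set (padded_pairs \<beta> as ns)" "v \<in> late_vars N" for a v
      using that by (auto simp: padded_pairs_def late_vars_def)
    then show ?thesis
      using kill_vars_key_poly_at[of "padded_pairs \<beta> as ns" "late_vars N"] that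
      by (simp add: filter_padded_pairs map_fst_padded_pairs map_snd_padded_pairs P_def)
  qed
  have "\<exists>N. Poly_Mapping.keys m \<inter> late_vars N = {}" for m :: "yxz monom"
  proof -
    \<comment> \<open>A monomial has finitely many variables, so some N exceeds all second indices
      of its X variables; the default 0 for Y and Z does not affect this bound.\<close>
    have "finite ((\<lambda>v. case v of X i k \<Rightarrow> k | _ \<Rightarrow> 0) ` Poly_Mapping.keys m)"
      by simp
    then obtain N where "\<forall>n\<in>(\<lambda>v. case v of X i k \<Rightarrow> k | _ \<Rightarrow> 0) ` Poly_Mapping.keys m. n < N"
      by (auto simp only: finite_nat_set_iff_bounded)
    then have "Poly_Mapping.keys m \<inter> late_vars N = {}"
      by (fastforce simp: late_vars_def)
    then show ?thesis ..
  qed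
  then obtain N where N: "Poly_Mapping.keys m \<inter> late_vars (N m) = {}" for m :: "yxz monom"
    by metis
  have "mcoeff (P ns) m = mcoeff (P (replicate (length as) (N m))) m"
    if "length ns = length as" "\<forall>n\<in>set ns. N m \<le> n" for ns m
    using mcoeff_kill_vars[OF N[of m], where p = "P ns"] kill[OF that] by simp
  \<comment> \<open>The limit coefficient at \<open>m\<close> is read off where all n_i equal the
    threshold \<open>N m\<close>, which depends on \<open>m\<close> alone.\<close>
  then have "has_mfps_limit (length as) P (\<lambda>m. mcoeff (P (replicate (length as) (N m))) m)"
    unfolding has_mfps_limit_def by blast
  then show ?thesis
    unfolding P_def by blast
qed

end
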